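(* Let $n\ge 6$ and let $\mathbb F$ be a field. Let $M$ be an abstract $2$-rigidity matroid on $\binom{[n]}{2}$ that is representable over $\mathbb F$ and in which every copy of $K_{3,3}$ is a circuit. Then $M$ can be represented by a standard two-dimensional hyperconnectivity matrix over $\mathbb F$; that is, there are $q_1,\dots,q_n\in\mathbb F^2$ such that $M$ is the column matroid of $H(q_1,\dots,q_n)$.
   Context: Write $ij$ for $\{i,j\}\in\binom{[n]}{2}$. An abstract $2$-rigidity matroid on $\binom{[n]}{2}$ is a matroid $M$ with ground set $\binom{[n]}{2}$ such that $\operatorname{rank}M=2n-3$ and, for every $T\subseteq[n]$ with $|T|=4$, the edge set $\binom{T}{2}$ is a circuit of $M$. A copy of $K_{3,3}$ is the edge set $\{st:s\in S,\ t\in T\}$ for disjoint $S,T\subseteq[n]$ with $|S|=|T|=3$. Hyperconnectivity matrix (transposed): for $q_i=(c_i,d_i)\in\mathbb F^2$, $i\in[n]$, the matrix $H(q_1,\dots,q_n)$ has rows $C_1,D_1,\dots,C_n,D_n$ and one column for each edge $ij$, $i<j$; the column $ij$ has entries $c_j,\ d_j,\ -c_i,\ -d_i$ in rows $C_i,D_i,C_j,D_j$ respectively, and all other entries zero. *)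

theory Defs
  imports Complex_Main "HOL-Library.Ramsey" "HOL-Library.Function_Algebras"
begin

locale matroid =
  fixes ground :: "'e set" and \<I> :: "'e set \<Rightarrow> bool"
  assumes finite_ground: "finite ground"
    and indep_ground: "\<I> X \<Longrightarrow> X \<subseteq> ground"
    and indep_empty: "\<I> {}"
    and indep_mono: "\<I> Y \<Longrightarrow> X \<subseteq> Y \<Longrightarrow> \<I> X"
    and indep_augment: "\<I> X \<Longrightarrow> \<I> Y \<Longrightarrow> card X < card Y
      \<Longrightarrow> \<exists>y \<in> Y - X. \<I> (insert y X)"
begin

definition rank :: nat where
  "rank = Max (card ` {X. \<I> X})"

definition circuit :: "'e set \<Rightarrow> bool" where
  "circuit X \<longleftrightarrow> X \<subseteq> ground \<and> \<not> \<I> X \<and> (\<forall>Y. Y \<subset> X \<longrightarrow> \<I> Y)"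

end

definition fun_scale :: "'f::field \<Rightarrow> ('r \<Rightarrow> 'f) \<Rightarrow> 'r \<Rightarrow> 'f" where
  "fun_scale a v = (\<lambda>r. a * v r)"

global_interpretation fun_space: vector_space "fun_scale :: 'f::field \<Rightarrow> ('r \<Rightarrow> 'f) \<Rightarrow> 'r \<Rightarrow> 'f"
  by unfold_locales (auto simp: fun_scale_def plus_fun_def algebra_simps)

text \<open>A matrix with row set \<open>R\<close> and columns labelled by \<open>'e\<close> is a function \<open>'r \<Rightarrow> 'e \<Rightarrow> 'f\<close>;
  its columns are vectors of \<open>F\<^sup>R\<close>, extended by zero outside \<open>R\<close>.\<close>

definition column :: "'r set \<Rightarrow> ('r \<Rightarrow> 'e \<Rightarrow> 'f::field) \<Rightarrow> 'e \<Rightarrow> 'r \<Rightarrow> 'f" where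
  "column R A e = (\<lambda>r. if r \<in> R then A r e else 0)"

text \<open>Independence in a column matroid is linear independence of the \<^emph>\<open>family\<close> of columns, so
  two labels with the same column are dependent; hence the injectivity condition.\<close>

definition column_indep :: "'r set \<Rightarrow> 'e set \<Rightarrow> ('r \<Rightarrow> 'e \<Rightarrow> 'f::field) \<Rightarrow> 'e set \<Rightarrow> bool" where
  "column_indep R E A X \<longleftrightarrow>
     X \<subseteq> E \<and> inj_on (column R A) X \<and> fun_space.independent (column R A ` X)"

definition representable_over :: "'f::field itself \<Rightarrow> 'e set \<Rightarrow> ('e set \<Rightarrow> bool) \<Rightarrow> bool" where
  "representable_over _ E \<I> \<longleftrightarrow>
     (\<exists>(m::nat) (A :: nat \<Rightarrow> 'e \<Rightarrow> 'f). \<I> = column_indep {..<m} E A)"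

definition abstract_2_rigidity_matroid :: "nat \<Rightarrow> (nat set set \<Rightarrow> bool) \<Rightarrow> bool" where
  "abstract_2_rigidity_matroid n \<I> \<longleftrightarrow>
     matroid (nsets {1..n} 2) \<I> \<and>
     int (matroid.rank \<I>) = 2 * int n - 3 \<and>
     (\<forall>T. T \<subseteq> {1..n} \<and> card T = 4 \<longrightarrow> matroid.circuit (nsets {1..n} 2) \<I> (nsets T 2))"

definition is_K33_copy :: "nat \<Rightarrow> nat set set \<Rightarrow> bool" where
  "is_K33_copy n K \<longleftrightarrow> (\<exists>S T. S \<subseteq> {1..n} \<and> T \<subseteq> {1..n} \<and> S \<inter> T = {} \<and> card S = 3 \<and> card T = 3 \<and>
     K = {{s, t} | s t. s \<in> S \<and> t \<in> T})"

datatype hyper_row = RowC nat | RowD nat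

definition hyper_rows :: "nat \<Rightarrow> hyper_row set" where
  "hyper_rows n = RowC ` {1..n} \<union> RowD ` {1..n}"

text \<open>For an edge \<open>{i, j}\<close> with \<open>i < j\<close>, \<open>Min\<close> and \<open>Max\<close> recover \<open>i\<close> and \<open>j\<close>.\<close>

fun hyper_matrix :: "(nat \<Rightarrow> 'f \<times> 'f::field) \<Rightarrow> hyper_row \<Rightarrow> nat set \<Rightarrow> 'f" where
  "hyper_matrix q (RowC k) e =
     (if k = Min e then fst (q (Max e)) else if k = Max e then - fst (q (Min e)) else 0)"
| "hyper_matrix q (RowD k) e =
     (if k = Min e then snd (q (Max e)) else if k = Max e then - snd (q (Min e)) else 0)"

end

(* Only the kernel of the representing matrix matters. The edges meeting {1, 2} form a basis, and the
   K4-circuits on {1, 2, i, j} express every other column v_ij in it, with coefficients a_ij, a_ji at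
   1i, 1j; b_ij, b_ji at 2i, 2j; and g_ij at 12. The circuits on {1, i, j, k} and {2, i, j, k} say that,
   up to rescaling the columns 2i, the b_ij are antisymmetric with g_ij = b_ij (G_j - G_i), and similarly
   that, up to rescaling the columns 1i, the a_ij are antisymmetric with g_ij = a_ij (F_j - F_i).
   The K33-circuit on {1, 2, 3 | j, k, l} forces a_3j / b_3j to be an affine function of G_j, so that
   F is a Moebius transform of G, and then r_i = alpha + beta (G_i - G_3) gives the coordinates
   q_1 = (1, 0), q_2 = (0, 1), q_i = (r_i, 1). *)

theory Submission
  imports Defs
begin

subsection \<open>Coordinates from circuit coefficients\<close>

text \<open>Normalise at the base point: the values of \<open>b\<close> and \<open>g\<close> on
  pairs containing \<open>i0\<close> force \<open>t\<close> and \<open>G\<close> up to the choice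
  \<open>t i0 = 1\<close>, \<open>G i0 = 0\<close>. For any other pair \<open>i\<close>,
  \<open>j\<close>, the relation on \<open>i0\<close>, \<open>i\<close>, \<open>j\<close> expresses
  \<open>b i j\<close>, \<open>b j i\<close> and \<open>g i j\<close> through values at
  \<open>i0\<close>, so the two identities carry over.\<close>

lemma cocycle_trivialisation:
  fixes b g :: "'i \<Rightarrow> 'i \<Rightarrow> 'f::field"
  assumes "i0 \<in> I"
    and b_nz: "\<And>i j. i \<in> I \<Longrightarrow> j \<in> I \<Longrightarrow> i \<noteq> j \<Longrightarrow> b i j \<noteq> 0"
    and g_sym: "\<And>i j. g i j = g j i"
    and triple: "\<And>i j k. i \<in> I \<Longrightarrow> j \<in> I \<Longrightarrow> k \<in> I \<Longrightarrow> i \<noteq> j \<Longrightarrow> i \<noteq> k \<Longrightarrow> j \<noteq> k \<Longrightarrow>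
      \<exists>x y z. x \<noteq> 0 \<and> y \<noteq> 0 \<and> z \<noteq> 0 \<and>
        x * b i j + y * b i k = 0 \<and> x * b j i + z * b j k = 0 \<and> y * b k i + z * b k j = 0 \<and>
        x * g i j + y * g i k + z * g j k = 0"
  shows "\<exists>t G. (\<forall>i\<in>I. t i \<noteq> 0) \<and> (\<forall>i\<in>I. \<forall>j\<in>I. i \<noteq> j \<longrightarrow>
    b j i * t j = - (b i j * t i) \<and> g i j = b i j * t i * (G j - G i))"
proof -
  \<comment> \<open>\<open>t i\<close> is the solution of the antisymmetry condition for the pair
    \<open>i0\<close>, \<open>i\<close>; likewise \<open>G i\<close> below solves the equation for
    \<open>g i0 i\<close>.\<close>
  define t where "t i = (if i = i0 then 1 else - b i0 i / b i i0)" for i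
  define G where "G i = (if i = i0 then 0 else g i0 i / b i0 i)" for i
  have t_nz: "t i \<noteq> 0" if "i \<in> I" for i
    using b_nz that \<open>i0 \<in> I\<close> by (auto simp: t_def)
  have "b j i * t j = - (b i j * t i) \<and> g i j = b i j * t i * (G j - G i)"
    if ij: "i \<in> I" "j \<in> I" "i \<noteq> j" for i j
  proof -
    consider "i = i0" | "j = i0" | "i \<noteq> i0" "j \<noteq> i0" by blast
    then show ?thesis
    proof cases
      case 1
      then show ?thesis using b_nz[of i0 j] b_nz[of j i0] ij by (simp add: t_def G_def)
    next
      case 2
      then show ?thesis using b_nz[of i0 i] b_nz[of i i0] ij g_sym[of i i0]
        by (simp add: t_def G_def)
    next
      case 3
      have nz: "b i0 i \<noteq> 0" "b i i0 \<noteq> 0" "b i0 j \<noteq> 0" "b j i0 \<noteq> 0"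
        using b_nz 3 ij \<open>i0 \<in> I\<close> by auto
      obtain x y z where xyz: "x \<noteq> 0" "y \<noteq> 0" "z \<noteq> 0"
        and e1: "x * b i0 i + y * b i0 j = 0" and e2: "x * b i i0 + z * b i j = 0"
        and e3: "y * b j i0 + z * b j i = 0"
        and e4: "x * g i0 i + y * g i0 j + z * g i j = 0"
        using triple[of i0 i j] 3 ij \<open>i0 \<in> I\<close> by auto
      \<comment> \<open>The factors \<open>b i i0\<close> and \<open>b j i0\<close> cancel against
        \<open>t\<close>, leaving \<open>x * b i0 i / z\<close> and \<open>y * b i0 j / z\<close>;
        these are opposite by \<open>e1\<close>.\<close>
      have ti: "b i j * t i = x * b i0 i / z"
      proof -
        have "b i j = - (x * b i i0 / z)"
          using e2 xyz by (simp add: field_simps eq_neg_iff_add_eq_0)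
        then show ?thesis using nz 3 xyz by (simp add: t_def)
      qed
      have tj: "b j i * t j = y * b i0 j / z"
      proof -
        have "b j i = - (y * b j i0 / z)"
          using e3 xyz by (simp add: field_simps eq_neg_iff_add_eq_0)
        then show ?thesis using nz 3 xyz by (simp add: t_def)
      qed
      have e1': "y * b i0 j = - (x * b i0 i)" using e1 by (simp add: eq_neg_iff_add_eq_0 add.commute)
      have "b i j * t i * (G j - G i) = (x * b i0 i * (g i0 j / b i0 j) - x * g i0 i) / z"
        using nz 3 xyz unfolding ti by (simp add: G_def field_simps)
      also have "x * b i0 i = - (y * b i0 j)" using e1' by simp
      also have "(- (y * b i0 j) * (g i0 j / b i0 j) - x * g i0 i) / z = - (x * g i0 i + y * g i0 j) / z"
        using nz by simp
      also have "\<dots> = g i j"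
      proof -
        have "z * g i j = - (x * g i0 i + y * g i0 j)"
          using e4 unfolding add_eq_0_iff .
        then show ?thesis using xyz by (simp add: field_simps)
      qed
      finally have "g i j = b i j * t i * (G j - G i)" by simp
      moreover have "b j i * t j = - (b i j * t i)" unfolding ti tj e1' by simp
      ultimately show ?thesis by blast
    qed
  qed
  with t_nz show ?thesis by blast
qed

text \<open>The factors \<open>t0\<close>, \<open>t1 i\<close>, \<open>t2 i\<close>, \<open>\<kappa> i j\<close> rescale the columns of the edges \<open>12\<close>, \<open>1i\<close>, \<open>2i\<close>, \<open>ij\<close>;
  the equations then match the circuit on \<open>{1, 2, i, j}\<close> with the one of the hyperconnectivity matrix
  for \<open>q\<^sub>1 = (1, 0)\<close>, \<open>q\<^sub>2 = (0, 1)\<close>, \<open>q\<^sub>i = (c i, 1)\<close>.\<close>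

definition hyper_scaling :: "'i set \<Rightarrow> ('i \<Rightarrow> 'i \<Rightarrow> 'f) \<Rightarrow> ('i \<Rightarrow> 'i \<Rightarrow> 'f) \<Rightarrow> ('i \<Rightarrow> 'i \<Rightarrow> 'f) \<Rightarrow>
    ('i \<Rightarrow> 'f) \<Rightarrow> ('i \<Rightarrow> 'f) \<Rightarrow> ('i \<Rightarrow> 'f) \<Rightarrow> 'f \<Rightarrow> ('i \<Rightarrow> 'i \<Rightarrow> 'f::field) \<Rightarrow> bool" where
  "hyper_scaling I a b g c t1 t2 t0 \<kappa> \<longleftrightarrow> t0 \<noteq> 0 \<and> (\<forall>i\<in>I. t1 i \<noteq> 0 \<and> t2 i \<noteq> 0) \<and>
    (\<forall>i\<in>I. \<forall>j\<in>I. i \<noteq> j \<longrightarrow> \<kappa> i j \<noteq> 0 \<and> \<kappa> j i = - \<kappa> i j \<and>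
      a i j * t1 i = \<kappa> i j * c j \<and> b i j * t2 i = \<kappa> i j \<and> g i j * t0 = \<kappa> i j * (c i - c j))"

text \<open>The cocycle lemma applies to \<open>b\<close> and to \<open>a\<close> separately and
  gives potentials \<open>G\<close> and \<open>F\<close> for the same \<open>g\<close>. The
  \<open>star\<close> relations tie them together: the ratio of the two normalised coefficients at
  \<open>i0\<close> is affine in \<open>G\<close>, and this affine function \<open>r\<close>
  supplies the coordinates.\<close>

lemma hyperconnectivity_coordinates:
  fixes a b g :: "'i \<Rightarrow> 'i \<Rightarrow> 'f::field"
  assumes base: "i0 \<in> I" "i1 \<in> I" "i2 \<in> I" "i0 \<noteq> i1" "i0 \<noteq> i2" "i1 \<noteq> i2"
    and nz: "\<And>i j. i \<in> I \<Longrightarrow> j \<in> I \<Longrightarrow> i \<noteq> j \<Longrightarrow> a i j \<noteq> 0 \<and> b i j \<noteq> 0 \<and> g i j \<noteq> 0"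
    and g_sym: "\<And>i j. g i j = g j i"
    and triple_a: "\<And>i j k. i \<in> I \<Longrightarrow> j \<in> I \<Longrightarrow> k \<in> I \<Longrightarrow> i \<noteq> j \<Longrightarrow> i \<noteq> k \<Longrightarrow> j \<noteq> k \<Longrightarrow>
      \<exists>x y z. x \<noteq> 0 \<and> y \<noteq> 0 \<and> z \<noteq> 0 \<and>
        x * a i j + y * a i k = 0 \<and> x * a j i + z * a j k = 0 \<and> y * a k i + z * a k j = 0 \<and>
        x * g i j + y * g i k + z * g j k = 0"
    and triple_b: "\<And>i j k. i \<in> I \<Longrightarrow> j \<in> I \<Longrightarrow> k \<in> I \<Longrightarrow> i \<noteq> j \<Longrightarrow> i \<noteq> k \<Longrightarrow> j \<noteq> k \<Longrightarrow>
      \<exists>x y z. x \<noteq> 0 \<and> y \<noteq> 0 \<and> z \<noteq> 0 \<and>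
        x * b i j + y * b i k = 0 \<and> x * b j i + z * b j k = 0 \<and> y * b k i + z * b k j = 0 \<and>
        x * g i j + y * g i k + z * g j k = 0 \<and> x * a i j + y * a i k \<noteq> 0"
    and star: "\<And>i j k l. i \<in> I \<Longrightarrow> j \<in> I \<Longrightarrow> k \<in> I \<Longrightarrow> l \<in> I \<Longrightarrow> distinct [i, j, k, l] \<Longrightarrow>
      \<exists>x y z. x \<noteq> 0 \<and> y \<noteq> 0 \<and> z \<noteq> 0 \<and>
        x * a i j + y * a i k + z * a i l = 0 \<and> x * b i j + y * b i k + z * b i l = 0 \<and>
        x * g i j + y * g i k + z * g i l = 0"
  shows "\<exists>c t1 t2 t0 \<kappa>. hyper_scaling I a b g c t1 t2 t0 \<kappa>"
proof -
  have b_nz: "b i j \<noteq> 0" and a_nz: "a i j \<noteq> 0" if "i \<in> I" "j \<in> I" "i \<noteq> j" for i j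
    using nz that by auto
  have triple_b': "\<exists>x y z. x \<noteq> 0 \<and> y \<noteq> 0 \<and> z \<noteq> 0 \<and>
        x * b i j + y * b i k = 0 \<and> x * b j i + z * b j k = 0 \<and> y * b k i + z * b k j = 0 \<and>
        x * g i j + y * g i k + z * g j k = 0"
    if "i \<in> I" "j \<in> I" "k \<in> I" "i \<noteq> j" "i \<noteq> k" "j \<noteq> k" for i j k
    using triple_b[OF that] by blast
  have cocycle_b: "\<exists>t G. (\<forall>i\<in>I. t i \<noteq> 0) \<and> (\<forall>i\<in>I. \<forall>j\<in>I. i \<noteq> j \<longrightarrow>
    b j i * t j = - (b i j * t i) \<and> g i j = b i j * t i * (G j - G i))"
    by (rule cocycle_trivialisation) (fact base(1) b_nz g_sym triple_b')+
  have cocycle_a: "\<exists>t G. (\<forall>i\<in>I. t i \<noteq> 0) \<and> (\<forall>i\<in>I. \<forall>j\<in>I. i \<noteq> j \<longrightarrow>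
    a j i * t j = - (a i j * t i) \<and> g i j = a i j * t i * (G j - G i))"
    by (rule cocycle_trivialisation) (fact base(1) a_nz g_sym triple_a)+
  obtain t G where t_nz: "\<And>i. i \<in> I \<Longrightarrow> t i \<noteq> 0"
    and t_anti: "\<And>i j. i \<in> I \<Longrightarrow> j \<in> I \<Longrightarrow> i \<noteq> j \<Longrightarrow> b j i * t j = - (b i j * t i)"
    and gG: "\<And>i j. i \<in> I \<Longrightarrow> j \<in> I \<Longrightarrow> i \<noteq> j \<Longrightarrow> g i j = b i j * t i * (G j - G i)"
    using cocycle_b by blast
  obtain t' F where t'_nz: "\<And>i. i \<in> I \<Longrightarrow> t' i \<noteq> 0"
    and t'_anti: "\<And>i j. i \<in> I \<Longrightarrow> j \<in> I \<Longrightarrow> i \<noteq> j \<Longrightarrow> a j i * t' j = - (a i j * t' i)"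
    and gF: "\<And>i j. i \<in> I \<Longrightarrow> j \<in> I \<Longrightarrow> i \<noteq> j \<Longrightarrow> g i j = a i j * t' i * (F j - F i)"
    using cocycle_a by blast
  define \<kappa> where "\<kappa> i j = b i j * t i" for i j
  \<comment> \<open>\<open>A\<close> compares the two normalisations. Both produce the same
    \<open>g i j\<close>, so \<open>A i j\<close> is the quotient of the difference of
    \<open>G\<close> by that of \<open>F\<close>.\<close>
  define A where "A i j = a i j * t' i / \<kappa> i j" for i j
  have \<kappa>_nz: "\<kappa> i j \<noteq> 0" and A_nz: "A i j \<noteq> 0" and G_neq: "G i \<noteq> G j" and F_neq: "F i \<noteq> F j"
    and a_eq: "a i j = A i j * \<kappa> i j / t' i" and b_eq: "b i j = \<kappa> i j / t i"
    and g_eq: "g i j = \<kappa> i j * (G j - G i)"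
    and A_eq: "A i j = (G j - G i) / (F j - F i)"
    if "i \<in> I" "j \<in> I" "i \<noteq> j" for i j
  proof -
    show k: "\<kappa> i j \<noteq> 0" using nz[OF that] t_nz that by (simp add: \<kappa>_def)
    show "A i j \<noteq> 0" using k nz[OF that] t'_nz that by (simp add: A_def)
    show G: "G i \<noteq> G j" using gG[OF that] nz[OF that] by auto
    show F: "F i \<noteq> F j" using gF[OF that] nz[OF that] by auto
    show "a i j = A i j * \<kappa> i j / t' i" using k t'_nz that by (simp add: A_def)
    show "b i j = \<kappa> i j / t i" using k t_nz that by (simp add: \<kappa>_def)
    show g: "g i j = \<kappa> i j * (G j - G i)" using gG[OF that] by (simp add: \<kappa>_def)
    show "A i j = (G j - G i) / (F j - F i)"
      using g gF[OF that] k F by (simp add: A_def field_simps)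
  qed
  \<comment> \<open>\<open>r\<close> interpolates \<open>A i0\<close> affinely in \<open>G\<close>
    through \<open>i1\<close> and \<open>i2\<close>; its constant term is chosen so that
    \<open>r i0 = \<alpha>\<close>.\<close>
  define \<beta> where "\<beta> = (A i0 i2 - A i0 i1) / (G i2 - G i1)"
  define \<alpha> where "\<alpha> = A i0 i1 - \<beta> * (G i1 - G i0)"
  define r where "r i = \<alpha> + \<beta> * (G i - G i0)" for i
  have G12: "G i2 - G i1 \<noteq> 0" using G_neq base by fastforce
  have r1: "A i0 i1 = r i1" by (simp add: r_def \<alpha>_def)
  have r2: "A i0 i2 = r i2"
  proof -
    have "r i2 = A i0 i1 + \<beta> * (G i2 - G i1)" by (simp add: r_def \<alpha>_def algebra_simps)
    then show ?thesis using G12 by (simp add: \<beta>_def)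
  qed
  have A_r: "A i0 j = r j" if j: "j \<in> I" "j \<noteq> i0" for j
  proof (cases "j = i1 \<or> j = i2")
    case True
    then show ?thesis using r1 r2 by auto
  next
    case False
    then obtain x y z where xyz: "x \<noteq> 0"
      and ea: "x * a i0 j + y * a i0 i1 + z * a i0 i2 = 0"
      and eb: "x * b i0 j + y * b i0 i1 + z * b i0 i2 = 0"
      and eg: "x * g i0 j + y * g i0 i1 + z * g i0 i2 = 0"
      using star[of i0 j i1 i2] base j by auto
    define X where "X = x * \<kappa> i0 j"
    define Y where "Y = y * \<kappa> i0 i1"
    define Z where "Z = z * \<kappa> i0 i2"
    have "t i0 \<noteq> 0" "t' i0 \<noteq> 0" using t_nz t'_nz base by auto
    have "(X + Y + Z) / t i0 = 0"
      using eb b_eq[of i0] base j by (simp add: X_def Y_def Z_def add_divide_distrib)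
    then have e1: "X + Y + Z = 0" using \<open>t i0 \<noteq> 0\<close> by simp
    have "(X * A i0 j + Y * A i0 i1 + Z * A i0 i2) / t' i0 = 0"
      using ea a_eq[of i0] base j by (simp add: X_def Y_def Z_def add_divide_distrib mult_ac)
    then have e2: "X * A i0 j + Y * r i1 + Z * r i2 = 0" using \<open>t' i0 \<noteq> 0\<close> by (simp add: r1 r2)
    have e3: "X * (G j - G i0) + Y * (G i1 - G i0) + Z * (G i2 - G i0) = 0"
      using eg g_eq[of i0] base j by (simp add: X_def Y_def Z_def mult_ac)
    \<comment> \<open>The circuit coefficients \<open>X\<close>, \<open>Y\<close>, \<open>Z\<close>
      annihilate the constants, \<open>G\<close> and \<open>A i0\<close>, hence also the difference
      of \<open>A i0\<close> and \<open>r\<close>. That difference vanishes at \<open>i1\<close> and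
      \<open>i2\<close>, so only the term at \<open>j\<close> survives.\<close>
    have "X * (A i0 j - r j) = (X * A i0 j + Y * r i1 + Z * r i2) - \<alpha> * (X + Y + Z)
        - \<beta> * (X * (G j - G i0) + Y * (G i1 - G i0) + Z * (G i2 - G i0))"
      by (simp add: r_def algebra_simps)
    then have "X * (A i0 j - r j) = 0" unfolding e1 e2 e3 by simp
    moreover have "X \<noteq> 0" using xyz \<kappa>_nz j base by (simp add: X_def)
    ultimately show ?thesis by simp
  qed
  \<comment> \<open>If \<alpha> were zero, \<open>G j - G i0\<close> would cancel in
    \<open>A i0 j = r j\<close>, leaving \<open>\<beta> = 1 / (F j - F i0)\<close> for every
    \<open>j\<close>, so \<open>F\<close> would agree at \<open>i1\<close> and
    \<open>i2\<close>.\<close>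
  have \<alpha>_nz: "\<alpha> \<noteq> 0"
  proof
    assume "\<alpha> = 0"
    have *: "\<beta> * (F j - F i0) = 1" if "j \<in> I" "j \<noteq> i0" for j
    proof -
      have "\<beta> * (G j - G i0) = (G j - G i0) / (F j - F i0)"
        using A_r[OF that] A_eq[of i0 j] that base \<open>\<alpha> = 0\<close> by (simp add: r_def)
      moreover have "G j - G i0 \<noteq> 0" "F j - F i0 \<noteq> 0"
        using G_neq[of i0 j] F_neq[of i0 j] that base by auto
      ultimately have "\<beta> = 1 / (F j - F i0)"
        by (metis mult_right_cancel times_divide_eq_left mult_1)
      then show ?thesis using \<open>F j - F i0 \<noteq> 0\<close> by simp
    qed
    have "\<beta> \<noteq> 0" using *[of i1] base by auto
    moreover have "\<beta> * (F i1 - F i0) = \<beta> * (F i2 - F i0)" using * base by simp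
    ultimately have "F i1 = F i2" by simp
    then show False using F_neq base by blast
  qed
  \<comment> \<open>If \<beta> were zero, the \<open>a\<close>- and \<open>b\<close>-coefficients at
    \<open>i0\<close> would be proportional, so a combination that kills \<open>b\<close> would also
    kill \<open>a\<close>. The last clause of \<open>triple_b\<close> excludes this.\<close>
  have \<beta>_nz: "\<beta> \<noteq> 0"
  proof
    assume "\<beta> = 0"
    then have A12: "A i0 i1 = A i0 i2" using r1 r2 by (simp add: r_def)
    obtain x y z where "x * b i0 i1 + y * b i0 i2 = 0" and ne: "x * a i0 i1 + y * a i0 i2 \<noteq> 0"
      using triple_b[of i0 i1 i2] base by blast
    then have "(x * \<kappa> i0 i1 + y * \<kappa> i0 i2) / t i0 = 0"
      using b_eq[of i0] base by (simp add: add_divide_distrib)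
    then have "x * \<kappa> i0 i1 + y * \<kappa> i0 i2 = 0" using t_nz base by simp
    moreover have "x * a i0 i1 + y * a i0 i2 = A i0 i1 / t' i0 * (x * \<kappa> i0 i1 + y * \<kappa> i0 i2)"
      using a_eq[of i0] base A12 by (simp add: algebra_simps add_divide_distrib)
    ultimately show False using ne by simp
  qed
  have r_nz: "r i \<noteq> 0" if "i \<in> I" for i
    using A_r[of i] A_nz[of i0 i] that base \<alpha>_nz by (cases "i = i0") (auto simp: r_def)
  \<comment> \<open>This is the Moebius form of \<open>F\<close>: its increment from
    \<open>i0\<close> is a linear function of \<open>G i\<close> divided by the affine function
    \<open>r i\<close>.\<close>
  have F_r: "F i - F i0 = (G i - G i0) / r i" if "i \<in> I" for i
  proof (cases "i = i0")
    case False
    then have "r i = (G i - G i0) / (F i - F i0)" using A_r A_eq that base by simp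
    moreover have "F i - F i0 \<noteq> 0" using F_neq[of i0 i] False that base by auto
    ultimately have "(F i - F i0) * r i = G i - G i0" by simp
    then show ?thesis using r_nz[OF that] by (metis nonzero_eq_divide_eq)
  qed simp
  \<comment> \<open>Subtracting two Moebius values gives the denominator \<open>r i * r j\<close>
    and, since \<open>r\<close> is affine in \<open>G\<close> with constant term \<alpha>, the
    numerator \<open>\<alpha> * (G j - G i)\<close>.\<close>
  have A_rr: "A i j * \<alpha> = r i * r j" if ij: "i \<in> I" "j \<in> I" "i \<noteq> j" for i j
  proof -
    have "F j - F i = (G j - G i0) / r j - (G i - G i0) / r i" using F_r ij by (simp flip: F_r)
    also have "\<dots> = ((G j - G i0) * r i - (G i - G i0) * r j) / (r i * r j)"
      using r_nz ij by (simp add: field_simps)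
    also have "(G j - G i0) * r i - (G i - G i0) * r j = \<alpha> * (G j - G i)"
      by (simp add: r_def algebra_simps)
    finally have F: "F j - F i = \<alpha> * (G j - G i) / (r i * r j)" .
    define D where "D = G j - G i"
    have "D \<noteq> 0" using G_neq[OF ij] by (simp add: D_def)
    moreover have "A i j = D / (\<alpha> * D / (r i * r j))" using A_eq[OF ij] F by (simp add: D_def)
    ultimately show ?thesis using \<alpha>_nz r_nz ij by (simp add: field_simps)
  qed
  \<comment> \<open>The product form of \<open>A i j\<close> splits by vertex: \<alpha> and
    \<open>r i\<close> go into the scaling of the column \<open>1i\<close>, and \<open>r j\<close>
    remains as the coordinate.\<close>
  have "a i j * (t' i * \<alpha> / r i) = \<kappa> i j * r j" if ij: "i \<in> I" "j \<in> I" "i \<noteq> j" for i j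
  proof -
    have "a i j * (t' i * \<alpha> / r i) = \<kappa> i j * (A i j * \<alpha>) / r i"
      using a_eq[OF ij] t'_nz ij by simp
    then show ?thesis using A_rr[OF ij] r_nz ij by simp
  qed
  \<comment> \<open>Differences of \<open>r\<close> are \<beta> times differences of
    \<open>G\<close>; the sign accounts for the reversed order of \<open>i\<close> and
    \<open>j\<close>.\<close>
  moreover have "g i j * (- \<beta>) = \<kappa> i j * (r i - r j)" if ij: "i \<in> I" "j \<in> I" "i \<noteq> j" for i j
    unfolding g_eq[OF ij] by (simp add: r_def algebra_simps)
  moreover have "b i j * t i = \<kappa> i j" for i j by (simp add: \<kappa>_def)
  moreover have "\<kappa> j i = - \<kappa> i j" if "i \<in> I" "j \<in> I" "i \<noteq> j" for i j
    using t_anti[OF that] by (simp add: \<kappa>_def)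
  moreover have "t' i * \<alpha> / r i \<noteq> 0" if "i \<in> I" for i
    using that t'_nz \<alpha>_nz r_nz by simp
  moreover have "- \<beta> \<noteq> 0" using \<beta>_nz by simp
  ultimately have "hyper_scaling I a b g r (\<lambda>i. t' i * \<alpha> / r i) t (- \<beta>) \<kappa>"
    unfolding hyper_scaling_def using t_nz \<kappa>_nz by blast
  then show ?thesis by blast
qed

subsection \<open>Column matroids\<close>

definition column_relation :: "'r set \<Rightarrow> ('r \<Rightarrow> 'e \<Rightarrow> 'f::field) \<Rightarrow> 'e set \<Rightarrow> ('e \<Rightarrow> 'f) \<Rightarrow> bool" where
  "column_relation R A X u \<longleftrightarrow> (\<forall>r\<in>R. (\<Sum>e\<in>X. u e * A r e) = 0)"

lemma sum_fun_apply: "(\<Sum>x\<in>X. f x) r = (\<Sum>x\<in>X. f x r)"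
  by (induction X rule: infinite_finite_induct) auto

lemma column_relation_iff:
  "column_relation R A X u \<longleftrightarrow> (\<Sum>e\<in>X. fun_scale (u e) (column R A e)) = 0"
proof -
  have "(\<Sum>e\<in>X. fun_scale (u e) (column R A e)) r = (if r \<in> R then \<Sum>e\<in>X. u e * A r e else 0)" for r
    by (simp add: sum_fun_apply fun_scale_def column_def)
  then show ?thesis by (auto simp: column_relation_def fun_eq_iff)
qed

text \<open>Restates independence through kernel vectors indexed by labels, so that two matrices can
  be compared by their kernels. Injectivity is absorbed: a repeated column is itself a nontrivial
  relation.\<close>

lemma column_indep_iff:
  fixes A :: "'r \<Rightarrow> 'e \<Rightarrow> 'f::field"
  assumes "finite E"
  shows "column_indep R E A X \<longleftrightarrow>
    X \<subseteq> E \<and> (\<forall>u. column_relation R A X u \<longrightarrow> (\<forall>e\<in>X. u e = 0))"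
proof (cases "X \<subseteq> E")
  case True
  then have fin: "finite X" using assms finite_subset by blast
  let ?v = "column R A"
  have inj: "inj_on ?v X" if *: "\<forall>u. column_relation R A X u \<longrightarrow> (\<forall>e\<in>X. u e = 0)"
  proof (rule inj_onI, rule ccontr)
    fix e f assume ef: "e \<in> X" "f \<in> X" "?v e = ?v f" "e \<noteq> f"
    \<comment> \<open>Two equal columns are cancelled by the coefficients \<open>1\<close> at
      \<open>e\<close> and \<open>-1\<close> at \<open>f\<close>.\<close>
    define u :: "'e \<Rightarrow> 'f" where "u = (\<lambda>x. (if x = e then 1 else 0) - (if x = f then 1 else 0))"
    have "(\<Sum>x\<in>X. u x * A r x) = 0" if "r \<in> R" for r
    proof -
      have "(\<Sum>x\<in>X. u x * A r x) = (\<Sum>x\<in>X. (if x = e then A r x else 0) - (if x = f then A r x else 0))"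
        by (rule sum.cong) (auto simp: u_def)
      also have "\<dots> = A r e - A r f" using ef fin by (simp add: sum_subtractf)
      also have "\<dots> = 0" using fun_cong[OF ef(3), of r] that by (simp add: column_def)
      finally show ?thesis .
    qed
    then have "u e = 0" using * ef by (auto simp: column_relation_def)
    then show False using ef by (simp add: u_def)
  qed
  have "fun_space.independent (?v ` X) \<longleftrightarrow> (\<forall>u. column_relation R A X u \<longrightarrow> (\<forall>e\<in>X. u e = 0))"
    if inj: "inj_on ?v X"
  proof -
    have ind: "fun_space.independent (?v ` X) \<longleftrightarrow>
        (\<forall>u. (\<Sum>e\<in>X. fun_scale (u (?v e)) (?v e)) = 0 \<longrightarrow> (\<forall>e\<in>X. u (?v e) = 0))"
      using fin inj by (auto simp: fun_space.dependent_finite sum.reindex)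
    show ?thesis unfolding ind
    proof (intro iffI allI impI)
      fix u assume *: "\<forall>u. (\<Sum>e\<in>X. fun_scale (u (?v e)) (?v e)) = 0 \<longrightarrow> (\<forall>e\<in>X. u (?v e) = 0)"
        and "column_relation R A X u"
      \<comment> \<open>Injectivity allows coefficients on labels to be transported to coefficients
        on column vectors.\<close>
      then have "(\<Sum>e\<in>X. fun_scale (u (the_inv_into X ?v (?v e))) (?v e)) = 0"
        using inj by (simp add: column_relation_iff the_inv_into_f_f cong: sum.cong)
      then show "\<forall>e\<in>X. u e = 0"
        using *[rule_format, of "\<lambda>x. u (the_inv_into X ?v x)"] inj by (simp add: the_inv_into_f_f)
    next
      fix u assume *: "\<forall>u. column_relation R A X u \<longrightarrow> (\<forall>e\<in>X. u e = 0)"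
        and "(\<Sum>e\<in>X. fun_scale (u (?v e)) (?v e)) = 0"
      then have "column_relation R A X (\<lambda>e. u (?v e))" unfolding column_relation_iff by blast
      then show "\<forall>e\<in>X. u (?v e) = 0" using *[rule_format, of "\<lambda>e. u (?v e)"] by blast
    qed
  qed
  then have "inj_on ?v X \<and> fun_space.independent (?v ` X) \<longleftrightarrow>
      (\<forall>u. column_relation R A X u \<longrightarrow> (\<forall>e\<in>X. u e = 0))"
    using inj by blast
  then show ?thesis using True unfolding column_indep_def by argo
qed (simp add: column_indep_def)

lemma column_relation_mono:
  assumes "finite Y" "X \<subseteq> Y" "\<And>e. e \<in> Y - X \<Longrightarrow> u e = 0"
  shows "column_relation R A Y u \<longleftrightarrow> column_relation R A X u"
proof -
  have "(\<Sum>e\<in>Y. u e * A r e) = (\<Sum>e\<in>X. u e * A r e)" for r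
    using assms by (intro sum.mono_neutral_right) auto
  then show ?thesis by (simp add: column_relation_def)
qed

text \<open>Dependence yields a nonzero relation. A zero coefficient in it would leave a relation on
  a proper subset of the circuit, which is independent, so the whole relation would vanish.\<close>

lemma column_circuit_relation:
  assumes "matroid E (column_indep R E A)" "matroid.circuit E (column_indep R E A) K"
  shows "\<exists>u. column_relation R A K u \<and> (\<forall>e\<in>K. u e \<noteq> 0)"
proof -
  have fin: "finite E" using assms(1) by (rule matroid.finite_ground)
  have K: "K \<subseteq> E" "\<not> column_indep R E A K" "\<And>Y. Y \<subset> K \<Longrightarrow> column_indep R E A Y"
    using assms by (auto simp: matroid.circuit_def)
  have finK: "finite K" using K(1) fin finite_subset by blast
  obtain u e where u: "column_relation R A K u" and e: "e \<in> K" "u e \<noteq> 0"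
    using K(1,2) by (auto simp: column_indep_iff[OF fin])
  have "u f \<noteq> 0" if f: "f \<in> K" for f
  proof
    assume 0: "u f = 0"
    then have "column_relation R A (K - {f}) u"
      using u column_relation_mono[of K "K - {f}" u R A] finK by auto
    moreover have "column_indep R E A (K - {f})" using K(3) f by auto
    ultimately have "\<forall>e\<in>K - {f}. u e = 0" by (simp add: column_indep_iff[OF fin])
    then show False using e 0 by auto
  qed
  with u show ?thesis by blast
qed

text \<open>The kernel is determined by the coordinates \<open>c\<close> with respect to a basis
  alone: expanding every column and exchanging sums turns a relation on \<open>E\<close> into one on
  \<open>B\<close>.\<close>

lemma column_relation_basis:
  assumes fin: "finite E" and B: "B \<subseteq> E"
    and ind: "\<And>u. column_relation R A B u \<Longrightarrow> \<forall>e\<in>B. u e = 0"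
    and coord: "\<And>r e. r \<in> R \<Longrightarrow> e \<in> E \<Longrightarrow> A r e = (\<Sum>b\<in>B. c e b * A r b)"
  shows "column_relation R A E u \<longleftrightarrow> (\<forall>b\<in>B. (\<Sum>e\<in>E. u e * c e b) = 0)"
proof -
  have eq: "(\<Sum>e\<in>E. u e * A r e) = (\<Sum>b\<in>B. (\<Sum>e\<in>E. u e * c e b) * A r b)" if "r \<in> R" for r
  proof -
    have "(\<Sum>e\<in>E. u e * A r e) = (\<Sum>e\<in>E. \<Sum>b\<in>B. u e * c e b * A r b)"
      using coord[OF that] by (simp add: sum_distrib_left mult.assoc cong: sum.cong)
    also have "\<dots> = (\<Sum>b\<in>B. (\<Sum>e\<in>E. u e * c e b) * A r b)"
      by (subst sum.swap) (simp add: sum_distrib_right)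
    finally show ?thesis .
  qed
  then have "column_relation R A E u \<longleftrightarrow> column_relation R A B (\<lambda>b. \<Sum>e\<in>E. u e * c e b)"
    by (simp add: column_relation_def)
  moreover have "column_relation R A B (\<lambda>b. \<Sum>e\<in>E. u e * c e b)"
    if "\<forall>b\<in>B. (\<Sum>e\<in>E. u e * c e b) = 0"
    using that by (simp add: column_relation_def)
  ultimately show ?thesis using ind[of "\<lambda>b. \<Sum>e\<in>E. u e * c e b"] by blast
qed

text \<open>Equal coordinates after rescaling the columns of \<open>A'\<close> by \<open>s\<close>
  give equal kernels, and rescaling columns by nonzero factors leaves the column matroid
  unchanged.\<close>

lemma column_indep_cong_basis:
  fixes A :: "'r \<Rightarrow> 'e \<Rightarrow> 'f::field" and A' :: "'s \<Rightarrow> 'e \<Rightarrow> 'f"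
  assumes fin: "finite E" and B: "B \<subseteq> E"
    and s: "\<And>e. e \<in> E \<Longrightarrow> s e \<noteq> 0"
    and ind: "\<And>u. column_relation R A B u \<Longrightarrow> \<forall>e\<in>B. u e = 0"
    and ind': "\<And>u. column_relation R' A' B u \<Longrightarrow> \<forall>e\<in>B. u e = 0"
    and coord: "\<And>e. e \<in> E - B \<Longrightarrow> \<exists>c. (\<forall>r\<in>R. A r e = (\<Sum>b\<in>B. c b * A r b)) \<and>
      (\<forall>r\<in>R'. s e * A' r e = (\<Sum>b\<in>B. c b * (s b * A' r b)))"
  shows "column_indep R E A = column_indep R' E A'"
proof -
  let ?A' = "\<lambda>r e. s e * A' r e"
  have finB: "finite B" using fin B finite_subset by blast
  have "\<exists>c. (\<forall>r\<in>R. A r e = (\<Sum>b\<in>B. c b * A r b)) \<and> (\<forall>r\<in>R'. ?A' r e = (\<Sum>b\<in>B. c b * ?A' r b))"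
    if "e \<in> E" for e
  proof (cases "e \<in> B")
    case True
    then show ?thesis using finB
      \<comment> \<open>A basis column has the unit vector as its coordinates in both
        matrices.\<close>
      by (intro exI[of _ "\<lambda>b. if b = e then 1 else 0"]) (simp add: if_distrib[of "\<lambda>x. x * _"] cong: if_cong)
  qed (use coord that in auto)
  then obtain c where c: "\<And>r e. e \<in> E \<Longrightarrow> r \<in> R \<Longrightarrow> A r e = (\<Sum>b\<in>B. c e b * A r b)"
    "\<And>r e. e \<in> E \<Longrightarrow> r \<in> R' \<Longrightarrow> ?A' r e = (\<Sum>b\<in>B. c e b * ?A' r b)"
    by metis
  have scale: "column_relation R' ?A' X u \<longleftrightarrow> column_relation R' A' X (\<lambda>e. u e * s e)" for X u
    by (simp add: column_relation_def mult.assoc)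
  have ind'': "\<forall>e\<in>B. u e = 0" if "column_relation R' ?A' B u" for u
    using ind'[of "\<lambda>e. u e * s e"] that s B by (auto simp: scale)
  have E_eq: "column_relation R A E u \<longleftrightarrow> column_relation R' ?A' E u" for u
  proof -
    have "column_relation R A E u \<longleftrightarrow> (\<forall>b\<in>B. (\<Sum>e\<in>E. u e * c e b) = 0)"
      by (rule column_relation_basis[OF fin B]) (use ind c(1) in blast)+
    also have "\<dots> \<longleftrightarrow> column_relation R' ?A' E u"
      by (rule column_relation_basis[OF fin B, symmetric]) (use ind'' c(2) in blast)+
    finally show ?thesis .
  qed
  have X_eq: "column_relation R A X u \<longleftrightarrow> column_relation R' ?A' X u" if "X \<subseteq> E" for X u
  proof -
    let ?u = "\<lambda>e::'e. if e \<in> X then u e else 0"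
    \<comment> \<open>Extending a relation on \<open>X\<close> by zero reduces the comparison to the
      full edge set.\<close>
    have *: "column_relation Q C X u \<longleftrightarrow> column_relation Q C E ?u" for Q :: "'t set" and C :: "'t \<Rightarrow> 'e \<Rightarrow> 'f"
      using column_relation_mono[of E X ?u Q C] fin that
      by (simp add: column_relation_def cong: sum.cong)
    show ?thesis using E_eq[of ?u] *[of R A] *[of R' ?A'] by simp
  qed
  have "(\<forall>u. column_relation R A X u \<longrightarrow> (\<forall>e\<in>X. u e = 0)) \<longleftrightarrow>
        (\<forall>u. column_relation R' A' X u \<longrightarrow> (\<forall>e\<in>X. u e = 0))" if X: "X \<subseteq> E" for X
  proof (intro iffI allI impI)
    fix u assume *: "\<forall>u. column_relation R A X u \<longrightarrow> (\<forall>e\<in>X. u e = 0)" and "column_relation R' A' X u"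
    then have "column_relation R' ?A' X (\<lambda>e. u e / s e)"
      using s X by (auto simp: scale column_relation_def subset_iff cong: sum.cong)
    then have "\<forall>e\<in>X. u e / s e = 0" using *[rule_format, of "\<lambda>e. u e / s e"] X_eq[OF X] by auto
    then show "\<forall>e\<in>X. u e = 0" using s X by auto
  next
    fix u assume *: "\<forall>u. column_relation R' A' X u \<longrightarrow> (\<forall>e\<in>X. u e = 0)" and "column_relation R A X u"
    then have "\<forall>e\<in>X. u e * s e = 0" using X_eq[OF X] scale by blast
    then show "\<forall>e\<in>X. u e = 0" using s X by auto
  qed
  then show ?thesis by (auto simp: fun_eq_iff column_indep_iff[OF fin])
qed

text \<open>By the exchange bound, every finite set spanning all the columns has at least
  \<open>card X\<close>, hence at least \<open>card B\<close>, elements. A repeated or redundant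
  column among those of \<open>B\<close> would give a smaller spanning set.\<close>

lemma column_basis_of_spanning:
  assumes fin: "finite E" and B: "B \<subseteq> E" "card B \<le> card X"
    and X: "column_indep R E A X"
    and span: "\<And>e. e \<in> E \<Longrightarrow> column R A e \<in> fun_space.span (column R A ` B)"
  shows "column_indep R E A B"
proof -
  let ?v = "column R A"
  have finB: "finite B" using fin B finite_subset by blast
  have bound: "card B \<le> card T" if "finite T" "fun_space.span (?v ` B) \<subseteq> fun_space.span T" for T
  proof -
    have "?v ` X \<subseteq> fun_space.span T" using X span that by (auto simp: column_indep_def)
    then have "card (?v ` X) \<le> card T"
      using fun_space.independent_span_bound[OF that(1), of "?v ` X"] X by (auto simp: column_indep_def)
    then show ?thesis using X B card_image[of ?v X] by (simp add: column_indep_def)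
  qed
  have "card B = card (?v ` B)" using bound[of "?v ` B"] finB card_image_le[OF finB, of ?v] by simp
  then have "inj_on ?v B" using finB by (simp add: eq_card_imp_inj_on)
  moreover have "fun_space.independent (?v ` B)"
  proof
    assume "fun_space.dependent (?v ` B)"
    then obtain b where b: "b \<in> ?v ` B" "b \<in> fun_space.span (?v ` B - {b})"
      by (auto simp: fun_space.dependent_def)
    then have "fun_space.span (?v ` B) = fun_space.span (?v ` B - {b})"
      using fun_space.span_redundant by (metis insert_Diff)
    then have "card B \<le> card (?v ` B - {b})" using bound[of "?v ` B - {b}"] finB by simp
    also have "\<dots> < card (?v ` B)" using b finB by (intro psubset_card_mono) auto
    finally show False using \<open>card B = _\<close> by simp
  qed
  ultimately show ?thesis using B by (simp add: column_indep_def)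
qed

subsection \<open>The basis of edges meeting \<open>{1, 2}\<close>\<close>

lemma nsets_four:
  assumes "distinct [p, q, r, s]"
  shows "nsets {p, q, r, s} 2 = {{p, q}, {p, r}, {p, s}, {q, r}, {q, s}, {r, s}}"
  using assms by (auto simp: nsets_2_eq)

lemma sum_nsets_four:
  assumes "distinct [p, q, r, s]"
  shows "(\<Sum>e\<in>nsets {p, q, r, s} 2. f e) =
    f {p, q} + f {p, r} + f {p, s} + f {q, r} + f {q, s} + f {r, s}"
proof -
  have "distinct [{p, q}, {p, r}, {p, s}, {q, r}, {q, s}, {r, s}]"
    using assms by (auto simp: doubleton_eq_iff)
  then show ?thesis unfolding nsets_four[OF assms] by (simp add: add.assoc)
qed

lemma sum_complete_bipartite:
  assumes "S \<inter> T = {}"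
  shows "(\<Sum>e\<in>{{s, t} | s t. s \<in> S \<and> t \<in> T}. f e) = (\<Sum>s\<in>S. \<Sum>t\<in>T. f {s, t})"
proof -
  have "{{s, t} | s t. s \<in> S \<and> t \<in> T} = (\<lambda>(s, t). {s, t}) ` (S \<times> T)" by auto
  moreover have "inj_on (\<lambda>(s, t). {s, t}) (S \<times> T)"
    using assms by (auto simp: inj_on_def doubleton_eq_iff)
  ultimately show ?thesis
    by (simp add: sum.reindex sum.cartesian_product case_prod_unfold)
qed

lemma sum_K33:
  assumes "distinct [p, q, r, x, y, z]"
  shows "(\<Sum>e\<in>{{s, t} | s t. s \<in> {p, q, r} \<and> t \<in> {x, y, z}}. f e) =
    f {p, x} + f {p, y} + f {p, z} + f {q, x} + f {q, y} + f {q, z} + f {r, x} + f {r, y} + f {r, z}"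
proof -
  have "{p, q, r} \<inter> {x, y, z} = {}" using assms by auto
  then show ?thesis using assms unfolding sum_complete_bipartite[OF \<open>_ = {}\<close>]
    by (simp add: add.assoc)
qed

lemma hyper_matrix_edge:
  assumes "p < r"
  shows "hyper_matrix q (RowC k) {p, r} = (if k = p then fst (q r) else if k = r then - fst (q p) else 0)"
    "hyper_matrix q (RowD k) {p, r} = (if k = p then snd (q r) else if k = r then - snd (q p) else 0)"
proof -
  have "Min {p, r} = p" "Max {p, r} = r" using assms by auto
  then show "hyper_matrix q (RowC k) {p, r} = (if k = p then fst (q r) else if k = r then - fst (q p) else 0)"
    "hyper_matrix q (RowD k) {p, r} = (if k = p then snd (q r) else if k = r then - snd (q p) else 0)"
    by (simp_all only: hyper_matrix.simps)
qed

section \<open>The frame and coefficient vectors on it\<close>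

definition frame :: "nat \<Rightarrow> nat set set" where
  "frame n = insert {1, 2} ((\<lambda>i. {1, i}) ` {3..n} \<union> (\<lambda>i. {2, i}) ` {3..n})"

lemma sum_frame:
  fixes f :: "nat set \<Rightarrow> 'a::comm_monoid_add"
  shows "(\<Sum>e\<in>frame n. f e) = f {1, 2} + (\<Sum>i\<in>{3..n}. f {1, i} + f {2, i})"
proof -
  let ?P = "(\<lambda>i. {1, i}) ` {3..n}" and ?Q = "(\<lambda>i. {2, i}) ` {3..n}"
  have "{1, 2} \<noteq> {1, i}" "{1, 2} \<noteq> {2, i}" "{1, i} \<noteq> {2, j}" if "i \<in> {3..n}" "j \<in> {3..n}" for i j
    using that unfolding doubleton_eq_iff by simp_all
  then have "{1, 2} \<notin> ?P \<union> ?Q" "?P \<inter> ?Q = {}"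
    by blast+
  then have "(\<Sum>e\<in>frame n. f e) = f {1, 2} + ((\<Sum>e\<in>?P. f e) + (\<Sum>e\<in>?Q. f e))"
    by (simp add: frame_def sum.union_disjoint)
  also have "(\<Sum>e\<in>?P. f e) = (\<Sum>i\<in>{3..n}. f {1, i})"
    by (subst sum.reindex) (auto simp: inj_on_def doubleton_eq_iff)
  also have "(\<Sum>e\<in>?Q. f e) = (\<Sum>i\<in>{3..n}. f {2, i})"
    by (subst sum.reindex) (auto simp: inj_on_def doubleton_eq_iff)
  finally show ?thesis by (simp add: sum.distrib)
qed

lemma card_frame: "card (frame n) = 1 + 2 * (n - 2)"
proof -
  have "card (frame n) = (\<Sum>e\<in>frame n. 1)" by simp
  then show ?thesis unfolding sum_frame by simp
qed

lemma frame_subset: "n \<ge> 2 \<Longrightarrow> frame n \<subseteq> nsets {1..n} 2"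
  by (auto simp: frame_def nsets_def)

lemma edge_notin_frame:
  assumes "e \<in> nsets {1..n} 2" "e \<notin> frame n"
  obtains i j where "e = {i, j}" "3 \<le> i" "i < j" "j \<le> n"
proof -
  obtain i j where ij: "e = {i, j}" "1 \<le> i" "i < j" "j \<le> n"
  proof -
    obtain x y where "e = {x, y}" "x \<in> {1..n}" "y \<in> {1..n}" "x \<noteq> y"
      using assms(1) unfolding nsets_2_eq by blast
    then show thesis using that[of x y] that[of y x] by (cases "x < y") (auto simp: insert_commute)
  qed
  have "3 \<le> i"
  proof (rule ccontr)
    assume "\<not> 3 \<le> i"
    then have "i = 1 \<or> i = 2" using ij by auto
    moreover have "j = 2 \<or> j \<in> {3..n}" using ij by auto
    ultimately have "e \<in> frame n" using ij by (auto simp: frame_def)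
    then show False using assms by simp
  qed
  then show thesis using that ij by blast
qed

text \<open>Packs the coefficients at \<open>12\<close>, \<open>1i\<close> and \<open>2i\<close>
  into one function on edges; for \<open>i \<ge> 3\<close>, \<open>Max\<close> recovers
  \<open>i\<close>.\<close>

definition frame_vec :: "'a \<Rightarrow> (nat \<Rightarrow> 'a) \<Rightarrow> (nat \<Rightarrow> 'a) \<Rightarrow> nat set \<Rightarrow> 'a" where
  "frame_vec x0 x1 x2 e = (if 1 \<in> e then if 2 \<in> e then x0 else x1 (Max e) else x2 (Max e))"

lemma frame_vec_simps [simp]:
  "frame_vec x0 x1 x2 {1, 2} = x0" "frame_vec x0 x1 x2 {Suc 0, 2} = x0"
  "i \<ge> 3 \<Longrightarrow> frame_vec x0 x1 x2 {1, i} = x1 i" "i \<ge> 3 \<Longrightarrow> frame_vec x0 x1 x2 {Suc 0, i} = x1 i"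
  "i \<ge> 3 \<Longrightarrow> frame_vec x0 x1 x2 {2, i} = x2 i"
  by (auto simp: frame_vec_def)

lemma sum_frame_vec:
  fixes f :: "nat set \<Rightarrow> 'a::semiring_0"
  assumes "J \<subseteq> {3..n}" "\<And>i. i \<notin> J \<Longrightarrow> x1 i = 0 \<and> x2 i = 0"
  shows "(\<Sum>e\<in>frame n. frame_vec x0 x1 x2 e * f e) =
    x0 * f {1, 2} + (\<Sum>i\<in>J. x1 i * f {1, i} + x2 i * f {2, i})"
proof -
  have "(\<Sum>i\<in>{3..n}. frame_vec x0 x1 x2 {1, i} * f {1, i} + frame_vec x0 x1 x2 {2, i} * f {2, i}) =
      (\<Sum>i\<in>{3..n}. x1 i * f {1, i} + x2 i * f {2, i})"
    by (rule sum.cong) auto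
  also have "\<dots> = (\<Sum>i\<in>J. x1 i * f {1, i} + x2 i * f {2, i})"
    using assms by (intro sum.mono_neutral_right) auto
  finally show ?thesis by (simp add: sum_frame)
qed

section \<open>Frame coordinates of the columns of a fixed representation\<close>

locale K33_representation =
  fixes n :: nat and R :: "'r set" and A :: "'r \<Rightarrow> nat set \<Rightarrow> 'f::field"
  assumes n_ge: "n \<ge> 6"
    and matroid: "matroid (nsets {1..n} 2) (column_indep R (nsets {1..n} 2) A)"
    and rank: "matroid.rank (column_indep R (nsets {1..n} 2) A) = 2 * n - 3"
    and K4_circuit: "T \<subseteq> {1..n} \<Longrightarrow> card T = 4 \<Longrightarrow>
      matroid.circuit (nsets {1..n} 2) (column_indep R (nsets {1..n} 2) A) (nsets T 2)"
    and K33_circuit: "is_K33_copy n K \<Longrightarrow>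
      matroid.circuit (nsets {1..n} 2) (column_indep R (nsets {1..n} 2) A) K"
begin

lemma finite_edges: "finite (nsets {1..n} 2)"
  by (simp add: finite_imp_finite_nsets)

lemma K4_relation:
  assumes "distinct [p, q, r, s]" "{p, q, r, s} \<subseteq> {1..n}"
  shows "\<exists>u. (\<forall>e\<in>nsets {p, q, r, s} 2. u e \<noteq> 0) \<and> (\<forall>x\<in>R.
    u {p, q} * A x {p, q} + u {p, r} * A x {p, r} + u {p, s} * A x {p, s} +
    u {q, r} * A x {q, r} + u {q, s} * A x {q, s} + u {r, s} * A x {r, s} = 0)"
proof -
  have "matroid.circuit (nsets {1..n} 2) (column_indep R (nsets {1..n} 2) A) (nsets {p, q, r, s} 2)"
    using assms by (intro K4_circuit) auto
  then obtain u where "column_relation R A (nsets {p, q, r, s} 2) u"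
    "\<forall>e\<in>nsets {p, q, r, s} 2. u e \<noteq> 0"
    using column_circuit_relation[OF matroid] by blast
  then show ?thesis unfolding column_relation_def sum_nsets_four[OF assms(1)] by blast
qed

text \<open>The choice depends only on the set \<open>{1, 2, i, j}\<close>, so the same relation is
  chosen for \<open>i j\<close> and for \<open>j i\<close>.\<close>

definition K4_vec :: "nat \<Rightarrow> nat \<Rightarrow> nat set \<Rightarrow> 'f" where
  "K4_vec i j = (SOME u. (\<forall>e\<in>nsets {1, 2, i, j} 2. u e \<noteq> 0) \<and>
     column_relation R A (nsets {1, 2, i, j} 2) u)"

text \<open>The coefficients are normalised so that the column \<open>ij\<close> has coefficient
  \<open>1\<close>. In \<open>coef_a\<close> and \<open>coef_b\<close> below, the first index names
  the endpoint joined to \<open>1\<close> or \<open>2\<close>.\<close>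

definition coef_g :: "nat \<Rightarrow> nat \<Rightarrow> 'f" where
  "coef_g i j = K4_vec i j {1, 2} / K4_vec i j {i, j}"

definition coef_a :: "nat \<Rightarrow> nat \<Rightarrow> 'f" where
  "coef_a i j = K4_vec i j {1, i} / K4_vec i j {i, j}"

definition coef_b :: "nat \<Rightarrow> nat \<Rightarrow> 'f" where
  "coef_b i j = K4_vec i j {2, i} / K4_vec i j {i, j}"

lemma K4_vec_commute: "K4_vec i j = K4_vec j i"
  by (simp add: K4_vec_def insert_commute)

lemma coef_g_commute: "coef_g i j = coef_g j i"
  by (simp add: coef_g_def K4_vec_commute[of i j] insert_commute)

lemma coef:
  assumes ij: "i \<in> {3..n}" "j \<in> {3..n}" "i \<noteq> j"
  shows coef_nz: "coef_a i j \<noteq> 0 \<and> coef_b i j \<noteq> 0 \<and> coef_g i j \<noteq> 0"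
    and column_expand: "x \<in> R \<Longrightarrow> A x {i, j} = - (coef_g i j * A x {1, 2} +
      coef_a i j * A x {1, i} + coef_a j i * A x {1, j} +
      coef_b i j * A x {2, i} + coef_b j i * A x {2, j})"
proof -
  have d: "distinct [1, 2, i, j]" using ij by auto
  have sub: "{1, 2, i, j} \<subseteq> {1..n}" using ij by auto
  have "\<exists>u. (\<forall>e\<in>nsets {1, 2, i, j} 2. u e \<noteq> 0) \<and> column_relation R A (nsets {1, 2, i, j} 2) u"
    using K4_relation[OF d sub] unfolding column_relation_def sum_nsets_four[OF d] .
  then have nz: "\<forall>e\<in>nsets {1, 2, i, j} 2. K4_vec i j e \<noteq> 0"
    and rel: "column_relation R A (nsets {1, 2, i, j} 2) (K4_vec i j)"
    using someI_ex[of "\<lambda>u. (\<forall>e\<in>nsets {1, 2, i, j} 2. u e \<noteq> 0) \<and>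
      column_relation R A (nsets {1, 2, i, j} 2) u"] unfolding K4_vec_def by blast+
  let ?w = "K4_vec i j"
  have w: "?w {1, 2} \<noteq> 0" "?w {1, i} \<noteq> 0" "?w {1, j} \<noteq> 0" "?w {2, i} \<noteq> 0" "?w {2, j} \<noteq> 0"
    "?w {i, j} \<noteq> 0"
    using nz unfolding nsets_four[OF d] by simp_all
  then show "coef_a i j \<noteq> 0 \<and> coef_b i j \<noteq> 0 \<and> coef_g i j \<noteq> 0"
    by (simp add: coef_a_def coef_b_def coef_g_def)
  assume "x \<in> R"
  then have "?w {1, 2} * A x {1, 2} + ?w {1, i} * A x {1, i} + ?w {1, j} * A x {1, j} +
      ?w {2, i} * A x {2, i} + ?w {2, j} * A x {2, j} + ?w {i, j} * A x {i, j} = 0"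
    using rel unfolding column_relation_def sum_nsets_four[OF d] by blast
  then have "?w {i, j} * A x {i, j} = - (?w {1, 2} * A x {1, 2} + ?w {1, i} * A x {1, i} +
      ?w {1, j} * A x {1, j} + ?w {2, i} * A x {2, i} + ?w {2, j} * A x {2, j})"
    unfolding add_eq_0_iff .
  then have "A x {i, j} = - (?w {1, 2} * A x {1, 2} + ?w {1, i} * A x {1, i} +
      ?w {1, j} * A x {1, j} + ?w {2, i} * A x {2, i} + ?w {2, j} * A x {2, j}) / ?w {i, j}"
    using w(6) by (metis nonzero_mult_div_cancel_left)
  moreover have "coef_a j i = ?w {1, j} / ?w {i, j}" "coef_b j i = ?w {2, j} / ?w {i, j}"
    by (simp_all add: coef_a_def coef_b_def K4_vec_commute[of j i] insert_commute)
  ultimately show "A x {i, j} = - (coef_g i j * A x {1, 2} +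
      coef_a i j * A x {1, i} + coef_a j i * A x {1, j} +
      coef_b i j * A x {2, i} + coef_b j i * A x {2, j})"
    by (simp add: coef_a_def coef_b_def coef_g_def diff_divide_distrib)
qed

text \<open>The expansions of the columns \<open>ij\<close> make the frame spanning, and its size
  equals the rank \<open>2 * n - 3\<close>, so it is a basis.\<close>

lemma frame_indep: "column_indep R (nsets {1..n} 2) A (frame n)"
proof -
  let ?E = "nsets {1..n} 2" and ?v = "column R A"
  have sub: "frame n \<subseteq> ?E" using frame_subset n_ge by simp
  have "finite {X. column_indep R ?E A X}"
    by (rule finite_subset[OF _ finite_Pow_iff[THEN iffD2, OF finite_edges]]) (auto simp: column_indep_def)
  moreover have "column_indep R ?E A {}" using matroid by (rule matroid.indep_empty)
  then have "{X. column_indep R ?E A X} \<noteq> {}" by blast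
  \<comment> \<open>The rank is a maximum over a finite nonempty family, so some independent
    \<open>X\<close> attains it.\<close>
  ultimately have "Max (card ` {X. column_indep R ?E A X}) \<in> card ` {X. column_indep R ?E A X}"
    by (intro Max_in finite_imageI) simp_all
  then have "2 * n - 3 \<in> card ` {X. column_indep R ?E A X}"
    using rank unfolding matroid.rank_def[OF matroid] by argo
  then obtain X where "2 * n - 3 = card X" "X \<in> {X. column_indep R ?E A X}"
    by (rule imageE)
  then have X: "column_indep R ?E A X" "card X = 2 * n - 3" by simp_all
  show ?thesis
  proof (rule column_basis_of_spanning[OF finite_edges sub _ X(1)])
    show "card (frame n) \<le> card X" using X n_ge by (simp add: card_frame)
    fix e assume e: "e \<in> ?E"
    let ?S = "fun_space.span (?v ` frame n)"
    show "?v e \<in> ?S"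
    proof (cases "e \<in> frame n")
      case True
      then show ?thesis by (intro fun_space.span_base) auto
    next
      case False
      then obtain i j where ij: "e = {i, j}" "3 \<le> i" "i < j" "j \<le> n"
        using edge_notin_frame e by blast
      have "?v e = - (fun_scale (coef_g i j) (?v {1, 2}) +
          fun_scale (coef_a i j) (?v {1, i}) + fun_scale (coef_a j i) (?v {1, j}) +
          fun_scale (coef_b i j) (?v {2, i}) + fun_scale (coef_b j i) (?v {2, j}))"
        using column_expand[of i j] ij by (auto simp: fun_eq_iff column_def fun_scale_def)
      moreover have "?v {1, 2} \<in> ?S" "?v {1, i} \<in> ?S" "?v {1, j} \<in> ?S" "?v {2, i} \<in> ?S" "?v {2, j} \<in> ?S"
        using ij by (auto intro!: fun_space.span_base imageI simp: frame_def)
      ultimately show ?thesis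
        by (simp only: fun_space.span_neg fun_space.span_add fun_space.span_scale)
    qed
  qed
qed

lemma frame_relation_trivial:
  assumes "column_relation R A (frame n) u" "e \<in> frame n"
  shows "u e = 0"
  using frame_indep assms unfolding column_indep_iff[OF finite_edges] by blast

section \<open>Comparison of frame coefficients in the remaining circuits\<close>

lemma frame_combination_zero:
  assumes J: "J \<subseteq> {3..n}"
    and zero: "\<And>x. x \<in> R \<Longrightarrow> x0 * A x {1, 2} + (\<Sum>i\<in>J. x1 i * A x {1, i} + x2 i * A x {2, i}) = 0"
  shows "x0 = 0 \<and> (\<forall>i\<in>J. x1 i = 0 \<and> x2 i = 0)"
proof -
  let ?x1 = "\<lambda>i. if i \<in> J then x1 i else 0" and ?x2 = "\<lambda>i. if i \<in> J then x2 i else 0"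
  let ?u = "frame_vec x0 ?x1 ?x2"
  have "column_relation R A (frame n) ?u"
    unfolding column_relation_def
  proof
    fix x assume "x \<in> R"
    have "(\<Sum>e\<in>frame n. ?u e * A x e) = x0 * A x {1, 2} + (\<Sum>i\<in>J. ?x1 i * A x {1, i} + ?x2 i * A x {2, i})"
      using J by (intro sum_frame_vec) auto
    also have "(\<Sum>i\<in>J. ?x1 i * A x {1, i} + ?x2 i * A x {2, i}) = (\<Sum>i\<in>J. x1 i * A x {1, i} + x2 i * A x {2, i})"
      by (rule sum.cong) auto
    finally show "(\<Sum>e\<in>frame n. ?u e * A x e) = 0" using zero[OF \<open>x \<in> R\<close>] by simp
  qed
  note u0 = frame_relation_trivial[OF this]
  have "x0 = 0" using u0[of "{1, 2}"] by (simp add: frame_def)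
  moreover have "x1 i = 0 \<and> x2 i = 0" if "i \<in> J" for i
  proof -
    have i: "i \<in> {3..n}" using that J by blast
    then have "{1, i} \<in> frame n" "{2, i} \<in> frame n" by (auto simp: frame_def)
    from u0[OF this(1)] u0[OF this(2)] show ?thesis using i that by simp
  qed
  ultimately show ?thesis by blast
qed

text \<open>Expanding the three triangle columns in the frame and comparing coefficients. The free
  \<open>p\<close> and \<open>q\<close> let one computation serve the circuits on
  \<open>{1, i, j, k}\<close> and on \<open>{2, i, j, k}\<close>.\<close>

lemma triangle_relation:
  assumes ijk: "i \<in> {3..n}" "j \<in> {3..n}" "k \<in> {3..n}" "i \<noteq> j" "i \<noteq> k" "j \<noteq> k"
    and eq: "\<And>r. r \<in> R \<Longrightarrow> (\<Sum>t\<in>{i, j, k}. p t * A r {1, t} + q t * A r {2, t}) +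
      x * A r {i, j} + y * A r {i, k} + z * A r {j, k} = 0"
  shows "x * coef_g i j + y * coef_g i k + z * coef_g j k = 0"
    "x * coef_a i j + y * coef_a i k = p i" "x * coef_a j i + z * coef_a j k = p j"
    "y * coef_a k i + z * coef_a k j = p k"
    "x * coef_b i j + y * coef_b i k = q i" "x * coef_b j i + z * coef_b j k = q j"
    "y * coef_b k i + z * coef_b k j = q k"
proof -
  \<comment> \<open>\<open>x1\<close> and \<open>x2\<close> collect the coefficients at
    \<open>1t\<close> and \<open>2t\<close> in the negative of the given relation, because the
    expansions carry a minus sign.\<close>
  define x1 where "x1 t = (if t = i then x * coef_a i j + y * coef_a i k
    else if t = j then x * coef_a j i + z * coef_a j k else y * coef_a k i + z * coef_a k j) - p t" for t
  define x2 where "x2 t = (if t = i then x * coef_b i j + y * coef_b i k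
    else if t = j then x * coef_b j i + z * coef_b j k else y * coef_b k i + z * coef_b k j) - q t" for t
  let ?x0 = "x * coef_g i j + y * coef_g i k + z * coef_g j k"
  have "?x0 = 0 \<and> (\<forall>t\<in>{i, j, k}. x1 t = 0 \<and> x2 t = 0)"
  proof (rule frame_combination_zero)
    show "{i, j, k} \<subseteq> {3..n}" using ijk by auto
    fix r assume r: "r \<in> R"
    have "?x0 * A r {1, 2} + (\<Sum>t\<in>{i, j, k}. x1 t * A r {1, t} + x2 t * A r {2, t}) =
      - ((\<Sum>t\<in>{i, j, k}. p t * A r {1, t} + q t * A r {2, t}) +
      x * A r {i, j} + y * A r {i, k} + z * A r {j, k})"
      using ijk r by (simp add: x1_def x2_def column_expand algebra_simps)
    then show "?x0 * A r {1, 2} + (\<Sum>t\<in>{i, j, k}. x1 t * A r {1, t} + x2 t * A r {2, t}) = 0"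
      unfolding eq[OF r] by simp
  qed
  then show "x * coef_g i j + y * coef_g i k + z * coef_g j k = 0"
    "x * coef_a i j + y * coef_a i k = p i" "x * coef_a j i + z * coef_a j k = p j"
    "y * coef_a k i + z * coef_a k j = p k"
    "x * coef_b i j + y * coef_b i k = q i" "x * coef_b j i + z * coef_b j k = q j"
    "y * coef_b k i + z * coef_b k j = q k"
    using ijk by (auto simp: x1_def x2_def)
qed

text \<open>The circuit on \<open>{1, i, j, k}\<close> contains no edge at \<open>2\<close>, so the
  \<open>b\<close>-coefficients must cancel at every vertex. At \<open>i\<close> the
  \<open>a\<close>-coefficients sum to that of the edge \<open>1i\<close>, which is nonzero in a
  circuit.\<close>

lemma triple_b:
  assumes ijk: "i \<in> {3..n}" "j \<in> {3..n}" "k \<in> {3..n}" "i \<noteq> j" "i \<noteq> k" "j \<noteq> k"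
  shows "\<exists>x y z. x \<noteq> 0 \<and> y \<noteq> 0 \<and> z \<noteq> 0 \<and>
    x * coef_b i j + y * coef_b i k = 0 \<and> x * coef_b j i + z * coef_b j k = 0 \<and>
    y * coef_b k i + z * coef_b k j = 0 \<and>
    x * coef_g i j + y * coef_g i k + z * coef_g j k = 0 \<and> x * coef_a i j + y * coef_a i k \<noteq> 0"
proof -
  have d: "distinct [1, i, j, k]" and sub: "{1, i, j, k} \<subseteq> {1..n}" using ijk by auto
  obtain u where nz: "\<forall>e\<in>nsets {1, i, j, k} 2. u e \<noteq> 0" and rel: "\<forall>x\<in>R.
    u {1, i} * A x {1, i} + u {1, j} * A x {1, j} + u {1, k} * A x {1, k} +
    u {i, j} * A x {i, j} + u {i, k} * A x {i, k} + u {j, k} * A x {j, k} = 0"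
    using K4_relation[OF d sub] by blast
  have "(\<Sum>t\<in>{i, j, k}. u {1, t} * A r {1, t} + 0 * A r {2, t}) +
      u {i, j} * A r {i, j} + u {i, k} * A r {i, k} + u {j, k} * A r {j, k} = 0" if "r \<in> R" for r
    using rel that ijk by (simp add: add.assoc)
  note * = triangle_relation[OF ijk this]
  have "u {1, i} \<noteq> 0" "u {i, j} \<noteq> 0" "u {i, k} \<noteq> 0" "u {j, k} \<noteq> 0"
    using nz unfolding nsets_four[OF d] by simp_all
  then show ?thesis using * by metis
qed

text \<open>The mirror image with the circuit on \<open>{2, i, j, k}\<close>, which has no edge at
  \<open>1\<close>.\<close>

lemma triple_a:
  assumes ijk: "i \<in> {3..n}" "j \<in> {3..n}" "k \<in> {3..n}" "i \<noteq> j" "i \<noteq> k" "j \<noteq> k"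
  shows "\<exists>x y z. x \<noteq> 0 \<and> y \<noteq> 0 \<and> z \<noteq> 0 \<and>
    x * coef_a i j + y * coef_a i k = 0 \<and> x * coef_a j i + z * coef_a j k = 0 \<and>
    y * coef_a k i + z * coef_a k j = 0 \<and>
    x * coef_g i j + y * coef_g i k + z * coef_g j k = 0"
proof -
  have d: "distinct [2, i, j, k]" and sub: "{2, i, j, k} \<subseteq> {1..n}" using ijk by auto
  obtain u where nz: "\<forall>e\<in>nsets {2, i, j, k} 2. u e \<noteq> 0" and rel: "\<forall>x\<in>R.
    u {2, i} * A x {2, i} + u {2, j} * A x {2, j} + u {2, k} * A x {2, k} +
    u {i, j} * A x {i, j} + u {i, k} * A x {i, k} + u {j, k} * A x {j, k} = 0"
    using K4_relation[OF d sub] by blast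
  have "(\<Sum>t\<in>{i, j, k}. 0 * A r {1, t} + u {2, t} * A r {2, t}) +
      u {i, j} * A r {i, j} + u {i, k} * A r {i, k} + u {j, k} * A r {j, k} = 0" if "r \<in> R" for r
    using rel that ijk by (simp add: add.assoc)
  note * = triangle_relation[OF ijk this]
  have "u {i, j} \<noteq> 0" "u {i, k} \<noteq> 0" "u {j, k} \<noteq> 0"
    using nz unfolding nsets_four[OF d] by simp_all
  then show ?thesis using * by metis
qed

text \<open>The \<open>K_{3,3}\<close> with sides \<open>{1, 2, i}\<close> and
  \<open>{j, k, l}\<close> contains none of the edges \<open>12\<close>, \<open>1i\<close>,
  \<open>2i\<close>. Expanding its columns \<open>ij\<close>, \<open>ik\<close>, \<open>il\<close>,
  the contributions at those three frame edges must therefore cancel.\<close>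

lemma star_relation:
  assumes ijkl: "i \<in> {3..n}" "j \<in> {3..n}" "k \<in> {3..n}" "l \<in> {3..n}" "distinct [i, j, k, l]"
  shows "\<exists>x y z. x \<noteq> 0 \<and> y \<noteq> 0 \<and> z \<noteq> 0 \<and>
    x * coef_a i j + y * coef_a i k + z * coef_a i l = 0 \<and>
    x * coef_b i j + y * coef_b i k + z * coef_b i l = 0 \<and>
    x * coef_g i j + y * coef_g i k + z * coef_g i l = 0"
proof -
  let ?K = "{{s, t} | s t. s \<in> {1, 2, i} \<and> t \<in> {j, k, l}}"
  have d: "distinct [1, 2, i, j, k, l]" using ijkl by auto
  have "is_K33_copy n ?K"
    unfolding is_K33_copy_def
    by (rule exI[of _ "{1, 2, i}"], rule exI[of _ "{j, k, l}"]) (use ijkl d in auto)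
  then have "matroid.circuit (nsets {1..n} 2) (column_indep R (nsets {1..n} 2) A) ?K"
    by (rule K33_circuit)
  then obtain u where rel: "column_relation R A ?K u" and nz: "\<forall>e\<in>?K. u e \<noteq> 0"
    using column_circuit_relation[OF matroid] by blast
  let ?x = "u {i, j}" and ?y = "u {i, k}" and ?z = "u {i, l}"
  \<comment> \<open>At \<open>t = i\<close> only the expansions contribute; at \<open>j\<close>,
    \<open>k\<close>, \<open>l\<close> the circuit also has its own edges \<open>1t\<close> and
    \<open>2t\<close>.\<close>
  define x1 where "x1 t = (if t = i then ?x * coef_a i j + ?y * coef_a i k + ?z * coef_a i l
    else u {i, t} * coef_a t i - u {1, t})" for t
  define x2 where "x2 t = (if t = i then ?x * coef_b i j + ?y * coef_b i k + ?z * coef_b i l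
    else u {i, t} * coef_b t i - u {2, t})" for t
  let ?w = "?x * coef_g i j + ?y * coef_g i k + ?z * coef_g i l"
  have "?w = 0 \<and> (\<forall>t\<in>{i, j, k, l}. x1 t = 0 \<and> x2 t = 0)"
  proof (rule frame_combination_zero)
    show "{i, j, k, l} \<subseteq> {3..n}" using ijkl by auto
    fix r assume r: "r \<in> R"
    have eq: "u {1, j} * A r {1, j} + u {1, k} * A r {1, k} + u {1, l} * A r {1, l} +
      u {2, j} * A r {2, j} + u {2, k} * A r {2, k} + u {2, l} * A r {2, l} +
      ?x * A r {i, j} + ?y * A r {i, k} + ?z * A r {i, l} = 0"
      using rel r unfolding column_relation_def sum_K33[OF d] by blast
    have "?w * A r {1, 2} + (\<Sum>t\<in>{i, j, k, l}. x1 t * A r {1, t} + x2 t * A r {2, t}) =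
      - (u {1, j} * A r {1, j} + u {1, k} * A r {1, k} + u {1, l} * A r {1, l} +
      u {2, j} * A r {2, j} + u {2, k} * A r {2, k} + u {2, l} * A r {2, l} +
      ?x * A r {i, j} + ?y * A r {i, k} + ?z * A r {i, l})"
    proof -
      have x1: "x1 i = ?x * coef_a i j + ?y * coef_a i k + ?z * coef_a i l"
        "x1 j = ?x * coef_a j i - u {1, j}" "x1 k = ?y * coef_a k i - u {1, k}"
        "x1 l = ?z * coef_a l i - u {1, l}"
        and x2: "x2 i = ?x * coef_b i j + ?y * coef_b i k + ?z * coef_b i l"
        "x2 j = ?x * coef_b j i - u {2, j}" "x2 k = ?y * coef_b k i - u {2, k}"
        "x2 l = ?z * coef_b l i - u {2, l}"
        using ijkl(5) by (auto simp: x1_def x2_def)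
      have sum4: "(\<Sum>t\<in>{i, j, k, l}. f t) = f i + f j + f k + f l" for f :: "nat \<Rightarrow> 'f"
        using ijkl(5) by (simp add: add.assoc)
      have ne: "i \<noteq> j" "i \<noteq> k" "i \<noteq> l" using ijkl(5) by auto
      note E = column_expand[OF ijkl(1,2) ne(1) r] column_expand[OF ijkl(1,3) ne(2) r]
        column_expand[OF ijkl(1,4) ne(3) r]
      show ?thesis
        unfolding sum4 x1 x2 E by (simp add: algebra_simps)
    qed
    then show "?w * A r {1, 2} + (\<Sum>t\<in>{i, j, k, l}. x1 t * A r {1, t} + x2 t * A r {2, t}) = 0"
      unfolding eq by simp
  qed
  then have "?x * coef_a i j + ?y * coef_a i k + ?z * coef_a i l = 0"
    "?x * coef_b i j + ?y * coef_b i k + ?z * coef_b i l = 0" "?w = 0"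
    by (auto simp: x1_def x2_def)
  moreover have "?x \<noteq> 0" "?y \<noteq> 0" "?z \<noteq> 0" by (rule nz[rule_format], blast)+
  ultimately show ?thesis by blast
qed

section \<open>Matching the representation with a hyperconnectivity matrix\<close>

lemma hyperconnectivity_representation:
  "\<exists>q :: nat \<Rightarrow> 'f \<times> 'f. column_indep R (nsets {1..n} 2) A =
    column_indep (hyper_rows n) (nsets {1..n} 2) (hyper_matrix q)"
proof -
  have base: "(3::nat) \<in> {3..n}" "(4::nat) \<in> {3..n}" "(5::nat) \<in> {3..n}"
    "(3::nat) \<noteq> 4" "(3::nat) \<noteq> 5" "(4::nat) \<noteq> 5"
    using n_ge by auto
  have "\<exists>c t1 t2 t0 \<kappa>. hyper_scaling {3..n} coef_a coef_b coef_g c t1 t2 t0 \<kappa>"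
    by (rule hyperconnectivity_coordinates[OF base])
      (fact coef_nz coef_g_commute triple_a triple_b star_relation)+
  then obtain c t1 t2 t0 \<kappa> where "hyper_scaling {3..n} coef_a coef_b coef_g c t1 t2 t0 \<kappa>"
    by blast
  then have t0: "t0 \<noteq> 0" and t_nz: "\<And>i. i \<in> {3..n} \<Longrightarrow> t1 i \<noteq> 0 \<and> t2 i \<noteq> 0"
    and coords: "\<And>i j. i \<in> {3..n} \<Longrightarrow> j \<in> {3..n} \<Longrightarrow> i \<noteq> j \<Longrightarrow> \<kappa> i j \<noteq> 0 \<and> \<kappa> j i = - \<kappa> i j \<and>
       coef_a i j * t1 i = \<kappa> i j * c j \<and> coef_b i j * t2 i = \<kappa> i j \<and>
       coef_g i j * t0 = \<kappa> i j * (c i - c j)"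
    unfolding hyper_scaling_def by blast+
  define q where "q i = (if i = 1 then (1, 0) else if i = 2 then (0, 1) else (c i, 1 :: 'f))" for i :: nat
  \<comment> \<open>The column scaling as a function of edges; \<open>Min\<close> and
    \<open>Max\<close> orient \<open>ij\<close> as the hyperconnectivity matrix does, which fixes
    the sign of the antisymmetric \<kappa>.\<close>
  define s where "s e = (if 1 \<in> e \<or> 2 \<in> e then frame_vec t0 t1 t2 e else \<kappa> (Min e) (Max e))" for e
  let ?H = "hyper_matrix q" and ?E = "nsets {1..n} 2"
  note H = hyper_matrix_edge[of _ _ q]
  have s12: "s {1, 2} = t0" and s1: "\<And>i. i \<ge> 3 \<Longrightarrow> s {1, i} = t1 i" and s2: "\<And>i. i \<ge> 3 \<Longrightarrow> s {2, i} = t2 i"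
    and s_ij: "\<And>i j. 3 \<le> i \<Longrightarrow> i < j \<Longrightarrow> s {i, j} = \<kappa> i j"
    by (auto simp: s_def)
  have "column_indep R ?E A = column_indep (hyper_rows n) ?E ?H"
  proof (rule column_indep_cong_basis[where B = "frame n" and s = s])
    show "finite ?E" by (rule finite_edges)
    show "frame n \<subseteq> ?E" using frame_subset n_ge by simp
    show "\<forall>e\<in>frame n. u e = 0" if "column_relation R A (frame n) u" for u
      using frame_relation_trivial[OF that] by blast
    show "s e \<noteq> 0" if "e \<in> ?E" for e
    proof (cases "e \<in> frame n")
      case True
      then show ?thesis using t0 t_nz s12 s1 s2 by (auto simp: frame_def)
    next
      case False
      then obtain i j where "e = {i, j}" "3 \<le> i" "i < j" "j \<le> n"
        using edge_notin_frame \<open>e \<in> ?E\<close> by blast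
      then show ?thesis using coords[of i j] s_ij by simp
    qed
    show "\<forall>e\<in>frame n. u e = 0" if rel: "column_relation (hyper_rows n) ?H (frame n) u" for u
    proof -
      have row: "u {1, 2} * ?H \<rho> {1, 2} + (\<Sum>i\<in>{3..n}. u {1, i} * ?H \<rho> {1, i} + u {2, i} * ?H \<rho> {2, i}) = 0"
        if "\<rho> \<in> hyper_rows n" for \<rho>
        using rel that unfolding column_relation_def sum_frame by blast
      \<comment> \<open>With \<open>q 1 = (1, 0)\<close> and \<open>q 2 = (0, 1)\<close>, among the
        frame columns row \<open>C_k\<close> meets only \<open>1k\<close> and row \<open>D_k\<close>
        only \<open>2k\<close>, each with entry \<open>-1\<close>. Once these coefficients vanish,
        row \<open>D_1\<close> isolates \<open>12\<close>.\<close>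
      have u12: "u {1, k} = 0 \<and> u {2, k} = 0" if k: "k \<in> {3..n}" for k
      proof -
        have rows: "RowC k \<in> hyper_rows n" "RowD k \<in> hyper_rows n" using k by (auto simp: hyper_rows_def)
        have "(\<Sum>i\<in>{3..n}. u {1, i} * ?H (RowC k) {1, i} + u {2, i} * ?H (RowC k) {2, i}) =
            (\<Sum>i\<in>{3..n}. if i = k then - u {1, i} else 0)"
          using k by (intro sum.cong) (auto simp: H q_def)
        moreover have "(\<Sum>i\<in>{3..n}. u {1, i} * ?H (RowD k) {1, i} + u {2, i} * ?H (RowD k) {2, i}) =
            (\<Sum>i\<in>{3..n}. if i = k then - u {2, i} else 0)"
          using k by (intro sum.cong) (auto simp: H q_def)
        moreover have "?H (RowC k) {1, 2} = 0" "?H (RowD k) {1, 2} = 0" using k by (auto simp: H)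
        ultimately show ?thesis using row[OF rows(1)] row[OF rows(2)] k by simp
      qed
      moreover have "u {1, 2} = 0"
      proof -
        have "RowD 1 \<in> hyper_rows n" using n_ge by (auto simp: hyper_rows_def)
        moreover have "?H (RowD 1) {1, 2} = 1" by (simp add: H q_def)
        ultimately show ?thesis using row[of "RowD 1"] u12 by simp
      qed
      ultimately show ?thesis by (auto simp: frame_def)
    qed
    fix e assume "e \<in> ?E - frame n"
    then obtain i j where e: "e = {i, j}" and ij: "3 \<le> i" "i < j" "j \<le> n"
      using edge_notin_frame by blast
    let ?x1 = "\<lambda>t. if t = i then - coef_a i j else if t = j then - coef_a j i else 0"
    let ?x2 = "\<lambda>t. if t = i then - coef_b i j else if t = j then - coef_b j i else 0"
    \<comment> \<open>The frame coordinates of the column \<open>ij\<close> read off from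
      \<open>column_expand\<close>; the same ones must work for the rescaled hyperconnectivity
      columns.\<close>
    let ?c = "frame_vec (- coef_g i j) ?x1 ?x2"
    have c_sum: "(\<Sum>b\<in>frame n. ?c b * f b) = - (coef_g i j * f {1, 2} +
      coef_a i j * f {1, i} + coef_a j i * f {1, j} +
      coef_b i j * f {2, i} + coef_b j i * f {2, j})" for f
    proof -
      have "(\<Sum>b\<in>frame n. ?c b * f b) =
        - coef_g i j * f {1, 2} + (\<Sum>t\<in>{i, j}. ?x1 t * f {1, t} + ?x2 t * f {2, t})"
        using ij by (intro sum_frame_vec) auto
      then show ?thesis using ij by (simp add: algebra_simps)
    qed
    have k: "coef_a i j * t1 i = \<kappa> i j * c j" "coef_a j i * t1 j = - \<kappa> i j * c i"
      "coef_b i j * t2 i = \<kappa> i j" "coef_b j i * t2 j = - \<kappa> i j"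
      "coef_g i j * t0 = \<kappa> i j * (c i - c j)"
      using coords[of i j] coords[of j i] ij by auto
    show "\<exists>c. (\<forall>r\<in>R. A r e = (\<Sum>b\<in>frame n. c b * A r b)) \<and>
      (\<forall>r\<in>hyper_rows n. s e * ?H r e = (\<Sum>b\<in>frame n. c b * (s b * ?H r b)))"
    proof (intro exI[of _ ?c] conjI ballI)
      show "A r e = (\<Sum>b\<in>frame n. ?c b * A r b)" if "r \<in> R" for r
        unfolding c_sum e using column_expand[of i j r] that ij by simp
      fix r assume "r \<in> hyper_rows n"
      have "(\<Sum>b\<in>frame n. ?c b * (s b * ?H r b)) = - ((coef_g i j * t0) * ?H r {1, 2} +
        (coef_a i j * t1 i) * ?H r {1, i} + (coef_a j i * t1 j) * ?H r {1, j} +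
        (coef_b i j * t2 i) * ?H r {2, i} + (coef_b j i * t2 j) * ?H r {2, j})"
        unfolding c_sum using ij by (simp only: s12 s1 s2 mult.assoc)
      also have "\<dots> = \<kappa> i j * ?H r {i, j}"
        \<comment> \<open>After scaling, \<kappa> factors out and the identity is the relation of
          the hyperconnectivity columns on \<open>{1, 2, i, j}\<close>, checked row by row.\<close>
        unfolding k using ij by (cases r) (auto simp: H q_def algebra_simps)
      finally show "s e * ?H r e = (\<Sum>b\<in>frame n. ?c b * (s b * ?H r b))"
        using s_ij ij by (simp add: e)
    qed
  qed
  then show ?thesis by blast
qed

end

theorem theorem1p6:
  fixes n :: nat and \<I> :: "nat set set \<Rightarrow> bool"
  assumes "n \<ge> 6"
    and "abstract_2_rigidity_matroid n \<I>"
    and "representable_over TYPE('f::field) (nsets {1..n} 2) \<I>"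
    and "\<And>K. is_K33_copy n K \<Longrightarrow> matroid.circuit (nsets {1..n} 2) \<I> K"
  shows "\<exists>q :: nat \<Rightarrow> 'f \<times> 'f.
           \<I> = column_indep (hyper_rows n) (nsets {1..n} 2) (hyper_matrix q)"
proof -
  obtain m and A :: "nat \<Rightarrow> nat set \<Rightarrow> 'f" where \<I>: "\<I> = column_indep {..<m} (nsets {1..n} 2) A"
    using assms(3) by (auto simp: representable_over_def)
  interpret K33_representation n "{..<m}" A
  proof (rule K33_representation.intro)
    note M = assms(2)[unfolded \<I> abstract_2_rigidity_matroid_def]
    show "n \<ge> 6" by (rule assms(1))
    show "matroid (nsets {1..n} 2) (column_indep {..<m} (nsets {1..n} 2) A)" using M by blast
    \<comment> \<open>The integer equation forces \<open>2 * n \<ge> 3\<close>, so it agrees with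
      the truncated subtraction on naturals.\<close>
    show "matroid.rank (column_indep {..<m} (nsets {1..n} 2) A) = 2 * n - 3" using M by linarith
    show "matroid.circuit (nsets {1..n} 2) (column_indep {..<m} (nsets {1..n} 2) A) (nsets T 2)"
      if "T \<subseteq> {1..n}" "card T = 4" for T using M that by blast
    show "matroid.circuit (nsets {1..n} 2) (column_indep {..<m} (nsets {1..n} 2) A) K"
      if "is_K33_copy n K" for K using assms(4)[OF that] unfolding \<I> .
  qed
  show ?thesis unfolding \<I> by (rule hyperconnectivity_representation)
qed

end
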